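(* Let $p\in(0,\infty]$, $\beta\in(0,1]$, $d\in\mathbb{N}$ and $\alpha\in(0,\infty)$, and let $\boldsymbol{\ell}:\mathbb{N}\to\mathbb{N}_{\ge 2}\cup\{\infty\}$ and $\boldsymbol{c}:\mathbb{N}\to\mathbb{N}\cup\{\infty\}$ be non-decreasing. Then: (i) If $p<\infty$ and $\gamma^\ast(\boldsymbol{\ell},\boldsymbol{c})>\frac{\alpha}{d/p}$, then the embedding $A^{\alpha,p}_{\boldsymbol{\ell},\boldsymbol{c}}([0,1]^d)\hookrightarrow C([0,1]^d)$ does not hold. (ii) If $\gamma^\ast(\boldsymbol{\ell},\boldsymbol{c})>\frac{1-\beta}{\beta+\frac{d}{p}}\,\alpha$, then the embedding $A^{\alpha,p}_{\boldsymbol{\ell},\boldsymbol{c}}([0,1]^d)\hookrightarrow C^{0,\beta}([0,1]^d)$ does not hold.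
   Context: $\mathbb{N}=\{1,2,3,\dots\}$. Convention: $d/p:=0$ if $p=\infty$. Neural networks: a neural network is a tuple $\Phi=((A_1,b_1),\dots,(A_L,b_L))$ with $L\in\mathbb{N}$, $A_j\in\mathbb{R}^{N_j\times N_{j-1}}$, $b_j\in\mathbb{R}^{N_j}$, $N_0,\dots,N_L\in\mathbb{N}$. Put $L(\Phi):=L$ (number of layers), $d_{\mathrm{in}}(\Phi):=N_0$, $d_{\mathrm{out}}(\Phi):=N_L$, $W(\Phi):=\sum_{j=1}^L(\|A_j\|_{\ell^0}+\|b_j\|_{\ell^0})$, where $\|\cdot\|_{\ell^0}$ counts non-zero entries, and $\|\Phi\|_{\mathcal{NN}}:=\max_j\max\{\|A_j\|_\infty,\|b_j\|_\infty\}$, where $\|\cdot\|_\infty$ is the largest absolute value of an entry. With the ReLU $\varrho(x)=\max\{0,x\}$ acting componentwise and $T_jx=A_jx+b_j$, the realization is $R_\varrho\Phi:=T_L\circ(\varrho\circ T_{L-1})\circ\cdots\circ(\varrho\circ T_1):\mathbb{R}^{N_0}\to\mathbb{R}^{N_L}$. Approximation spaces: $\Sigma_n^{\boldsymbol{\ell},\boldsymbol{c}}$ is the set of all $R_\varrho\Phi$ with $d_{\mathrm{in}}(\Phi)=d$, $d_{\mathrm{out}}(\Phi)=1$, $W(\Phi)\le n$, $L(\Phi)\le\boldsymbol{\ell}(n)$, $\|\Phi\|_{\mathcal{NN}}\le\boldsymbol{c}(n)$. For measurable $f:[0,1]^d\to\mathbb{R}$ let $d_p(f,\Sigma):=\inf_{g\in\Sigma}\|f-g\|_{L^p([0,1]^d)}$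 and $$\Gamma_{\alpha,p}(f):=\max\Big\{\|f\|_{L^p([0,1]^d)},\ \sup_{n\in\mathbb{N}}\big[n^\alpha\cdot d_p(f,\Sigma_n^{\boldsymbol{\ell},\boldsymbol{c}})\big]\Big\}\in[0,\infty],$$ $\|f\|_{A^{\alpha,p}_{\boldsymbol{\ell},\boldsymbol{c}}}:=\inf\{t>0:\Gamma_{\alpha,p}(f/t)\le1\}\in[0,\infty]$, and $A^{\alpha,p}_{\boldsymbol{\ell},\boldsymbol{c}}([0,1]^d):=\{f\in L^p([0,1]^d):\|f\|_{A^{\alpha,p}_{\boldsymbol{\ell},\boldsymbol{c}}}<\infty\}$ (a quasi-normed space). Complexity exponent: with $\boldsymbol{\ell}^\ast:=\sup_{n\in\mathbb{N}}\boldsymbol{\ell}(n)$ and $\mathbb{N}_{\le\boldsymbol{\ell}^\ast}:=\{L\in\mathbb{N}:L\le\boldsymbol{\ell}^\ast\}$ (all of $\mathbb{N}$ if $\boldsymbol{\ell}^\ast=\infty$), $$\gamma^\ast(\boldsymbol{\ell},\boldsymbol{c}):=\sup\Big\{\gamma\in[0,\infty):\exists\,L\in\mathbb{N}_{\le\boldsymbol{\ell}^\ast}:\ \limsup_{n\to\infty}\frac{(\boldsymbol{c}(n))^L\cdot n^{\lfloor L/2\rfloor}}{n^\gamma}\in(0,\infty]\Big\}\in(0,\infty].$$ $C([0,1]^d)$ carries the supremum norm. Hölder spaces: $\operatorname{Lip}_\beta(f):=\sup_{x\ne y\in[0,1]^d}\frac{|f(x)-f(y)|}{\|x-y\|_{\ell^\infty}^\beta}$,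 and $C^{0,\beta}([0,1]^d)$ consists of all $f:[0,1]^d\to\mathbb{R}$ with $\|f\|_{C^{0,\beta}}:=\|f\|_{L^\infty}+\operatorname{Lip}_\beta(f)<\infty$. An embedding $X\hookrightarrow Y$ means that every $f\in X$ belongs to $Y$ (after possibly changing $f$ on a null set) and there is $C>0$ with $\|f\|_Y\le C\|f\|_X$ for all $f\in X$. *)

theory Defs
  imports
    "HOL-Analysis.Analysis"
    "HOL-Probability.Essential_Supremum"
    "Jordan_Normal_Form.Matrix"
begin

section \<open>ReLU networks\<close>

text \<open>A network is the list of its layers $(A_1,b_1),\dots,(A_L,b_L)$, with $(A_1,b_1)$ at the
  head.\<close>

type_synonym network = "(real Matrix.mat \<times> real Matrix.vec) list"

definition is_network :: "network \<Rightarrow> bool" where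
  "is_network \<Phi> \<longleftrightarrow> \<Phi> \<noteq> [] \<and>
     (\<forall>(A, b) \<in> set \<Phi>. 0 < dim_row A \<and> 0 < dim_col A \<and> dim_vec b = dim_row A) \<and>
     (\<forall>j. Suc j < length \<Phi> \<longrightarrow> dim_col (fst (\<Phi> ! Suc j)) = dim_row (fst (\<Phi> ! j)))"

definition d_in :: "network \<Rightarrow> nat" where
  "d_in \<Phi> = dim_col (fst (hd \<Phi>))"

definition d_out :: "network \<Rightarrow> nat" where
  "d_out \<Phi> = dim_row (fst (last \<Phi>))"

definition l0_mat :: "real Matrix.mat \<Rightarrow> nat" where
  "l0_mat A = card {(i, j). i < dim_row A \<and> j < dim_col A \<and> A $$ (i, j) \<noteq> 0}"

definition l0_vec :: "real Matrix.vec \<Rightarrow> nat" where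
  "l0_vec b = card {i. i < dim_vec b \<and> vec_index b i \<noteq> 0}"

definition num_weights :: "network \<Rightarrow> nat" where
  "num_weights \<Phi> = (\<Sum>(A, b)\<leftarrow>\<Phi>. l0_mat A + l0_vec b)"

definition max_mat :: "real Matrix.mat \<Rightarrow> real" where
  "max_mat A = Max {\<bar>A $$ (i, j)\<bar> | i j. i < dim_row A \<and> j < dim_col A}"

definition max_vec :: "real Matrix.vec \<Rightarrow> real" where
  "max_vec b = Max {\<bar>vec_index b i\<bar> | i. i < dim_vec b}"

definition nn_norm :: "network \<Rightarrow> real" where
  "nn_norm \<Phi> = Max ((\<lambda>(A, b). max (max_mat A) (max_vec b)) ` set \<Phi>)"

definition relu :: "real \<Rightarrow> real" where
  "relu x = max 0 x"

text \<open>There is no activation after the last layer. The clause for the empty list is a dummy.\<close>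

fun realize :: "network \<Rightarrow> real Matrix.vec \<Rightarrow> real Matrix.vec" where
  "realize [] x = x"
| "realize [(A, b)] x = A *\<^sub>v x + b"
| "realize ((A, b) # \<Psi> # \<Phi>) x = realize (\<Psi> # \<Phi>) (map_vec relu (A *\<^sub>v x + b))"

text \<open>The ambient space is \<^typ>\<open>real ^ 'd\<close> with $d$ = \<^term>\<open>CARD('d)\<close>. To feed a point to a network,
  its coordinates are listed along the library's fixed enumeration
  \<^term>\<open>from_nat_into (UNIV :: 'd set)\<close>, a bijection from \<^term>\<open>{..<CARD('d)}\<close> onto the index type.
  The sets \<open>Sigma_nn\<close> below do not depend on the enumeration, since the columns of $A_1$ may be
  permuted.\<close>

definition coords :: "real ^ 'd \<Rightarrow> real Matrix.vec" where
  "coords x = Matrix.vec CARD('d) (\<lambda>i. vec_nth x (from_nat_into UNIV i))"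

text \<open>The growth functions \<^term>\<open>\<l> :: nat \<Rightarrow> enat\<close> and \<^term>\<open>c :: nat \<Rightarrow> enat\<close> are only relevant on
  positive arguments; their value at \<^term>\<open>0 :: nat\<close> is never used below (a limes superior at
  infinity ignores it).\<close>

definition Sigma_nn :: "(nat \<Rightarrow> enat) \<Rightarrow> (nat \<Rightarrow> enat) \<Rightarrow> nat \<Rightarrow> (real ^ 'd \<Rightarrow> real) set" where
  "Sigma_nn \<l> c n = {\<lambda>x. vec_index (realize \<Phi> (coords x)) 0 | \<Phi>.
     is_network \<Phi> \<and> d_in \<Phi> = CARD('d) \<and> d_out \<Phi> = 1 \<and> num_weights \<Phi> \<le> n \<and>
     enat (length \<Phi>) \<le> \<l> n \<and> ennreal (nn_norm \<Phi>) \<le> ennreal_of_enat (c n)}"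

section \<open>Approximation spaces\<close>

text \<open>Functions on the cube are represented by functions on the whole space; all notions below
  only depend on the values on the cube.\<close>

definition cube :: "(real ^ 'd) set" where
  "cube = cbox 0 1"

definition Lp_norm :: "ennreal \<Rightarrow> (real ^ 'd \<Rightarrow> real) \<Rightarrow> ennreal" where
  "Lp_norm p f =
     (if p = \<infinity> then esssup (lebesgue_on cube) (\<lambda>x. ennreal \<bar>f x\<bar>)
      else (let I = (\<integral>\<^sup>+x. ennreal (\<bar>f x\<bar> powr enn2real p) \<partial>lebesgue_on cube)
            in if I = \<infinity> then \<infinity> else ennreal (enn2real I powr (1 / enn2real p))))"

definition Lp_space :: "ennreal \<Rightarrow> (real ^ 'd \<Rightarrow> real) set" where
  "Lp_space p = {f \<in> borel_measurable (lebesgue_on cube). Lp_norm p f < \<infinity>}"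

definition Lp_dist :: "ennreal \<Rightarrow> (real ^ 'd \<Rightarrow> real) \<Rightarrow> (real ^ 'd \<Rightarrow> real) set \<Rightarrow> ennreal" where
  "Lp_dist p f S = (INF g\<in>S. Lp_norm p (\<lambda>x. f x - g x))"

definition Gamma_ap ::
  "real \<Rightarrow> ennreal \<Rightarrow> (nat \<Rightarrow> enat) \<Rightarrow> (nat \<Rightarrow> enat) \<Rightarrow> (real ^ 'd \<Rightarrow> real) \<Rightarrow> ennreal" where
  "Gamma_ap \<alpha> p \<l> c f =
     max (Lp_norm p f) (SUP n\<in>{1..}. ennreal (real n powr \<alpha>) * Lp_dist p f (Sigma_nn \<l> c n))"

definition A_norm ::
  "real \<Rightarrow> ennreal \<Rightarrow> (nat \<Rightarrow> enat) \<Rightarrow> (nat \<Rightarrow> enat) \<Rightarrow> (real ^ 'd \<Rightarrow> real) \<Rightarrow> ennreal" where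
  "A_norm \<alpha> p \<l> c f = (INF t\<in>{t. 0 < t \<and> Gamma_ap \<alpha> p \<l> c (\<lambda>x. f x / t) \<le> 1}. ennreal t)"

definition A_space ::
  "real \<Rightarrow> ennreal \<Rightarrow> (nat \<Rightarrow> enat) \<Rightarrow> (nat \<Rightarrow> enat) \<Rightarrow> (real ^ 'd \<Rightarrow> real) set" where
  "A_space \<alpha> p \<l> c = {f \<in> Lp_space p. A_norm \<alpha> p \<l> c f < \<infinity>}"

section \<open>Complexity exponent\<close>

definition gamma_star :: "(nat \<Rightarrow> enat) \<Rightarrow> (nat \<Rightarrow> enat) \<Rightarrow> ennreal" where
  "gamma_star \<l> c = (SUP \<gamma>\<in>{\<gamma>::real. 0 \<le> \<gamma> \<and>
     (\<exists>L::nat. 1 \<le> L \<and> enat L \<le> (SUP n\<in>{1..}. \<l> n) \<and>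
        0 < limsup (\<lambda>n. ennreal_of_enat (c n) ^ L * of_nat n ^ (L div 2) / ennreal (real n powr \<gamma>)))}.
     ennreal \<gamma>)"

section \<open>Continuous and Hoelder functions, embeddings\<close>

definition C_space :: "(real ^ 'd \<Rightarrow> real) set" where
  "C_space = {f. continuous_on cube f}"

definition C_norm :: "(real ^ 'd \<Rightarrow> real) \<Rightarrow> ennreal" where
  "C_norm f = (SUP x\<in>cube. ennreal \<bar>f x\<bar>)"

definition Lip_const :: "real \<Rightarrow> (real ^ 'd \<Rightarrow> real) \<Rightarrow> ennreal" where
  "Lip_const \<beta> f = (SUP (x, y)\<in>{(x, y). x \<in> cube \<and> y \<in> cube \<and> x \<noteq> y}.
     ennreal (\<bar>f x - f y\<bar> / infnorm (x - y) powr \<beta>))"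

definition Hoelder_norm :: "real \<Rightarrow> (real ^ 'd \<Rightarrow> real) \<Rightarrow> ennreal" where
  "Hoelder_norm \<beta> f = Lp_norm \<infinity> f + Lip_const \<beta> f"

definition Hoelder_space :: "real \<Rightarrow> (real ^ 'd \<Rightarrow> real) set" where
  "Hoelder_space \<beta> = {f. Hoelder_norm \<beta> f < \<infinity>}"

text \<open>The spaces $C([0,1]^d)$ and $C^{0,\beta}([0,1]^d)$ consist of continuous functions, so on the
  cube the representative \<open>g\<close> is uniquely determined by \<open>f\<close>.\<close>

definition embeds ::
  "(real ^ 'd \<Rightarrow> real) set \<Rightarrow> ((real ^ 'd \<Rightarrow> real) \<Rightarrow> ennreal) \<Rightarrow>
   (real ^ 'd \<Rightarrow> real) set \<Rightarrow> ((real ^ 'd \<Rightarrow> real) \<Rightarrow> ennreal) \<Rightarrow> bool" where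
  "embeds X normX Y normY \<longleftrightarrow>
     (\<exists>C>0. \<forall>f\<in>X. \<exists>g\<in>Y. (AE x in lebesgue_on cube. f x = g x) \<and> normY g \<le> ennreal C * normX f)"

definition d_over_p :: "nat \<Rightarrow> ennreal \<Rightarrow> real" where
  "d_over_p d p = (if p = \<infinity> then 0 else real d / enn2real p)"

end

theory Submission
  imports Defs "HOL-Real_Asymp.Real_Asymp"
begin

text \<open>One family of functions violates both embeddings, $f(x) = S \max(0, 1/M - \sum_i x_i)$, which
  on the cube is a bump of height $S/M$ supported in a corner of volume at most $M^{-d}$. A network
  of depth $L$ all of whose weights are $\pm C$, with layer widths alternating between $n$ and $1$,
  realizes $f$ with slope $S = C^L n^{\lfloor L/2 \rfloor}$ for every $M \ge 1$, using at most
  $N = (d+L) n$ weights. If $M$ is chosen such that $M^{1+d/p} = S N^\alpha$, then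
  $\|f\|_{L^p} \le N^{-\alpha}$, so $f$ lies in the unit ball of the approximation space, while the
  Hoelder quotient $(S/M) M^\beta$ between the corner and the point $e_i/M$ is unbounded as soon as
  $S \ge n^\gamma$ with $\gamma (\beta + d/p) > (1-\beta) \alpha$. The case $\beta = 0$ gives the
  statement about $C([0,1]^d)$.\<close>

section \<open>Constant-weight networks and the functions they realize\<close>

text \<open>Layers are counted from the output, so the output width is the one at index 0.\<close>

definition alternating_width :: "nat \<Rightarrow> nat \<Rightarrow> nat" where
  "alternating_width n k = (if odd k then n else 1)"

text \<open>Acts as an amplifier: on a constant nonnegative vector each layer multiplies the common
  entry by \<open>C\<close> times its input width, and the activations change nothing.\<close>

fun const_tail :: "real \<Rightarrow> nat \<Rightarrow> nat \<Rightarrow> network" where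
  "const_tail C n 0 = []"
| "const_tail C n (Suc k) =
     (Matrix.mat (alternating_width n k) (alternating_width n (Suc k)) (\<lambda>_. C),
      0\<^sub>v (alternating_width n k)) # const_tail C n k"

text \<open>All biases sit in the first layer, whose units are identical. The cutoff of the bump
  therefore happens at the first activation, and the remaining \<open>k\<close> layers only raise
  the slope. The depth is \<open>Suc k\<close>.\<close>

definition corner_net :: "nat \<Rightarrow> real \<Rightarrow> real \<Rightarrow> nat \<Rightarrow> nat \<Rightarrow> network" where
  "corner_net d C b n k =
     (Matrix.mat (alternating_width n k) d (\<lambda>_. - C),
      Matrix.vec (alternating_width n k) (\<lambda>_. b)) # const_tail C n k"

definition corner_bump :: "real \<Rightarrow> real \<Rightarrow> real ^ 'd \<Rightarrow> real" where
  "corner_bump S M x = S * max 0 (1 / M - (\<Sum>i\<in>UNIV. x $ i))"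

lemma alternating_width_pos: "1 \<le> n \<Longrightarrow> 0 < alternating_width n k"
  by (simp add: alternating_width_def)

lemma alternating_width_le: "1 \<le> n \<Longrightarrow> alternating_width n k \<le> n"
  by (simp add: alternating_width_def)

lemma length_const_tail [simp]: "length (const_tail C n k) = k"
  by (induction k) auto

lemma const_mat_mult_const_vec:
  fixes a s :: "'a :: comm_semiring_1"
  shows "Matrix.mat m N (\<lambda>_. a) *\<^sub>v Matrix.vec N (\<lambda>_. s) = Matrix.vec m (\<lambda>_. a * of_nat N * s)"
  by (rule eq_vecI) (auto simp: scalar_prod_def ac_simps)

text \<open>The factor \<open>n\<close> enters once for each layer with input width
  \<open>n\<close>. Input widths have the indices \<open>k\<close>, ..., \<open>1\<close>, and
  \<open>(k + 1) div 2\<close> of these are odd. Nonnegativity of \<open>C\<close> and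
  \<open>s\<close> makes every activation act as the identity.\<close>

lemma realize_const_tail:
  assumes "0 \<le> C" "0 \<le> s" "0 < k"
  shows "realize (const_tail C n k) (Matrix.vec (alternating_width n k) (\<lambda>_. s)) =
           Matrix.vec 1 (\<lambda>_. C ^ k * real n ^ ((k + 1) div 2) * s)"
  using assms
proof (induction k arbitrary: s)
  case 0
  then show ?case by simp
next
  case (Suc k)
  let ?s = "C * real (alternating_width n (Suc k)) * s"
  have layer: "Matrix.mat (alternating_width n k) (alternating_width n (Suc k)) (\<lambda>_. C) *\<^sub>v
      Matrix.vec (alternating_width n (Suc k)) (\<lambda>_. s) + 0\<^sub>v (alternating_width n k) =
      Matrix.vec (alternating_width n k) (\<lambda>_. ?s)"
    by (subst const_mat_mult_const_vec) (rule eq_vecI, auto)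
  \<comment> \<open>The case \<open>k = 0\<close> is the output layer, to which
    \<open>realize\<close> applies no activation.\<close>
  show ?case
  proof (cases k)
    case 0
    then show ?thesis using layer by (simp add: alternating_width_def)
  next
    case (Suc j)
    have s0: "0 \<le> ?s" using Suc.prems by simp
    have "map_vec relu (Matrix.vec (alternating_width n k) (\<lambda>_. ?s)) =
        Matrix.vec (alternating_width n k) (\<lambda>_. ?s)"
      using s0 by (intro eq_vecI) (auto simp: relu_def)
    then have "realize (const_tail C n (Suc k)) (Matrix.vec (alternating_width n (Suc k)) (\<lambda>_. s)) =
        realize (const_tail C n k) (Matrix.vec (alternating_width n k) (\<lambda>_. ?s))"
      using layer \<open>k = Suc j\<close> by simp
    also have "\<dots> = Matrix.vec 1 (\<lambda>_. C ^ k * real n ^ ((k + 1) div 2) * ?s)"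
      using Suc.IH[OF Suc.prems(1) s0] \<open>k = Suc j\<close> by simp
    \<comment> \<open>The width at \<open>Suc k\<close> is \<open>n\<close> exactly for even
      \<open>k\<close>, which is also when \<open>(k + 1) div 2\<close> increases by one on passing
      to \<open>Suc k\<close>.\<close>
    also have "C ^ k * real n ^ ((k + 1) div 2) * ?s =
        C ^ Suc k * real n ^ ((Suc k + 1) div 2) * s"
    proof (cases "odd k")
      case True
      then show ?thesis by (auto simp: alternating_width_def elim!: oddE)
    next
      case False
      then show ?thesis by (auto simp: alternating_width_def elim!: evenE)
    qed
    finally show ?thesis .
  qed
qed

text \<open>The bump sees a point only through its coordinate sum, so the enumeration behind
  \<open>coords\<close> drops out.\<close>

lemma sum_coords:
  "(\<Sum>i<CARD('d::finite). vec_index (coords (x :: real ^ 'd)) i) = (\<Sum>i\<in>UNIV. x $ i)"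
proof -
  have "bij_betw (from_nat_into (UNIV :: 'd set)) {..<CARD('d)} UNIV"
    by (rule bij_betw_from_nat_into_finite) simp
  from sum.reindex_bij_betw[OF this, of "\<lambda>i. x $ i"] show ?thesis
    by (simp add: coords_def)
qed

text \<open>With bias \<open>C / M\<close> every first-layer unit computes \<open>C\<close> times
  \<open>1 / M\<close> minus the coordinate sum. As \<open>0 \<le> C\<close>, the factor passes
  through the activation, which follows the first layer because \<open>0 < k\<close>.\<close>

lemma realize_corner_net:
  fixes x :: "real ^ 'd"
  assumes "0 \<le> C" "0 < k"
  shows "vec_index (realize (corner_net CARD('d) C (C / M) n k) (coords x)) 0 =
           corner_bump (C ^ Suc k * real n ^ ((k + 1) div 2)) M x"
proof -
  let ?w = "alternating_width n k"
  let ?t = "1 / M - (\<Sum>i\<in>UNIV. x $ i)"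
  have dim: "dim_vec (coords x) = CARD('d)" by (simp add: coords_def)
  have "Matrix.mat ?w CARD('d) (\<lambda>_. - C) *\<^sub>v coords x + Matrix.vec ?w (\<lambda>_. C / M) =
      Matrix.vec ?w (\<lambda>_. C * ?t)"
    using sum_coords[of x] dim
    by (intro eq_vecI)
       (auto simp: scalar_prod_def sum_negf atLeast0LessThan sum_distrib_left[symmetric] algebra_simps)
  moreover have "map_vec relu (Matrix.vec ?w (\<lambda>_. C * ?t)) = Matrix.vec ?w (\<lambda>_. C * max 0 ?t)"
    using assms(1) by (intro eq_vecI) (auto simp: relu_def max_mult_distrib_left)
  ultimately have "realize (corner_net CARD('d) C (C / M) n k) (coords x) =
      realize (const_tail C n k) (Matrix.vec ?w (\<lambda>_. C * max 0 ?t))"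
    using assms(2) by (cases k) (auto simp: corner_net_def)
  then show ?thesis
    using realize_const_tail[of C "C * max 0 ?t" k n] assms
    by (simp add: corner_bump_def mult_ac)
qed

section \<open>Dimensions, number of weights and size of weights\<close>

lemma hd_const_tail_dim:
  "0 < k \<Longrightarrow> dim_col (fst (const_tail C n k ! 0)) = alternating_width n k"
  by (cases k) auto

lemma const_tail_layers:
  assumes "(A, b) \<in> set (const_tail C n k)"
  obtains r s where "A = Matrix.mat r s (\<lambda>_. C)" "b = 0\<^sub>v r"
    "1 \<le> n \<Longrightarrow> 0 < r" "1 \<le> n \<Longrightarrow> 0 < s"
  using assms by (induction k) (auto simp: alternating_width_pos)

lemma const_tail_compatible:
  "Suc j < k \<Longrightarrow>
    dim_col (fst (const_tail C n k ! Suc j)) = dim_row (fst (const_tail C n k ! j))"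
proof (induction k arbitrary: j)
  case (Suc k)
  then show ?case
    by (cases j) (auto simp: hd_const_tail_dim)
qed simp

lemma is_network_corner_net:
  assumes "1 \<le> n" "0 < d"
  shows "is_network (corner_net d C b n k)"
  unfolding is_network_def
proof (intro conjI ballI allI impI)
  show "corner_net d C b n k \<noteq> []" by (simp add: corner_net_def)
next
  fix l assume "l \<in> set (corner_net d C b n k)"
  then show "case l of (A, b) \<Rightarrow> 0 < dim_row A \<and> 0 < dim_col A \<and> dim_vec b = dim_row A"
    using assms alternating_width_pos[OF assms(1)]
    by (cases l) (auto simp: corner_net_def elim!: const_tail_layers)
next
  fix j assume "Suc j < length (corner_net d C b n k)"
  then show "dim_col (fst (corner_net d C b n k ! Suc j)) =
      dim_row (fst (corner_net d C b n k ! j))"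
    by (cases j) (auto simp: corner_net_def hd_const_tail_dim const_tail_compatible)
qed

lemma d_out_corner_net: "0 < k \<Longrightarrow> d_out (corner_net d C b n k) = 1"
proof -
  have "0 < k \<Longrightarrow> dim_row (fst (last (const_tail C n k))) = 1"
  proof (induction k)
    case (Suc k)
    then show ?case by (cases k) (auto simp: alternating_width_def)
  qed simp
  then show "0 < k \<Longrightarrow> ?thesis"
    by (cases k) (auto simp: d_out_def corner_net_def)
qed

lemma l0_mat_le: "l0_mat A \<le> dim_row A * dim_col A"
proof -
  have "l0_mat A \<le> card ({..<dim_row A} \<times> {..<dim_col A})"
    unfolding l0_mat_def by (rule card_mono) auto
  then show ?thesis by (simp add: card_cartesian_product)
qed

lemma l0_vec_le: "l0_vec b \<le> dim_vec b"
proof -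
  have "l0_vec b \<le> card {..<dim_vec b}"
    unfolding l0_vec_def by (rule card_mono) auto
  then show ?thesis by simp
qed

lemma l0_zero: "l0_mat (0\<^sub>m r s) = 0" "l0_vec (0\<^sub>v r) = 0"
  unfolding l0_mat_def l0_vec_def by (rule card_eq_0_iff[THEN iffD2], rule disjI1, auto)+

text \<open>This is the reason for alternating the widths: of two consecutive widths one is 1, so a
  full matrix between them has only \<open>n\<close> entries, and the zero biases cost
  nothing.\<close>

lemma num_weights_const_tail: "num_weights (const_tail C n k) \<le> k * n"
proof (induction k)
  case 0
  then show ?case by (simp add: num_weights_def)
next
  case (Suc k)
  let ?A = "Matrix.mat (alternating_width n k) (alternating_width n (Suc k)) (\<lambda>_. C)"
  have "l0_mat ?A \<le> n"
    using l0_mat_le[of ?A] by (simp add: alternating_width_def split: if_splits)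
  with Suc show ?case by (simp add: num_weights_def l0_zero)
qed

lemma num_weights_corner_net:
  assumes "1 \<le> n"
  shows "num_weights (corner_net d C b n k) \<le> (d + Suc k) * n"
proof -
  let ?w = "alternating_width n k"
  have "l0_mat (Matrix.mat ?w d (\<lambda>_. - C)) \<le> n * d"
    using l0_mat_le[of "Matrix.mat ?w d (\<lambda>_. - C)"] alternating_width_le[OF assms, of k]
    by (simp add: order_trans[OF _ mult_le_mono1])
  moreover have "l0_vec (Matrix.vec ?w (\<lambda>_. b)) \<le> n"
    using l0_vec_le[of "Matrix.vec ?w (\<lambda>_. b)"] alternating_width_le[OF assms, of k] by simp
  ultimately show ?thesis
    using num_weights_const_tail[of C n k]
    by (simp add: num_weights_def corner_net_def algebra_simps)
qed

text \<open>Positive dimensions make the set under \<open>Max\<close> nonempty, without which its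
  value is unspecified.\<close>

lemma max_mat_le:
  assumes "0 < dim_row A" "0 < dim_col A"
    and "\<And>i j. i < dim_row A \<Longrightarrow> j < dim_col A \<Longrightarrow> \<bar>A $$ (i, j)\<bar> \<le> K"
  shows "max_mat A \<le> K"
proof -
  let ?E = "{\<bar>A $$ (i, j)\<bar> | i j. i < dim_row A \<and> j < dim_col A}"
  have "?E = (\<lambda>(i, j). \<bar>A $$ (i, j)\<bar>) ` ({..<dim_row A} \<times> {..<dim_col A})" by auto
  then have "finite ?E" by simp
  moreover have "?E \<noteq> {}" using assms(1,2) by blast
  ultimately show ?thesis
    unfolding max_mat_def using assms(3) by (auto simp: Max_le_iff)
qed

lemma max_vec_le:
  assumes "0 < dim_vec b" and "\<And>i. i < dim_vec b \<Longrightarrow> \<bar>vec_index b i\<bar> \<le> K"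
  shows "max_vec b \<le> K"
proof -
  let ?E = "{\<bar>vec_index b i\<bar> | i. i < dim_vec b}"
  have "finite ?E" by simp
  moreover have "?E \<noteq> {}" using assms(1) by blast
  ultimately show ?thesis
    unfolding max_vec_def using assms(2) by (auto simp: Max_le_iff)
qed

lemma nn_norm_le:
  assumes "\<Phi> \<noteq> []" and "\<And>A b. (A, b) \<in> set \<Phi> \<Longrightarrow> max_mat A \<le> K \<and> max_vec b \<le> K"
  shows "nn_norm \<Phi> \<le> K"
  unfolding nn_norm_def using assms by (subst Max_le_iff) auto

lemma nn_norm_corner_net:
  assumes "1 \<le> n" "0 < d" "0 \<le> C" "0 \<le> b" "b \<le> C"
  shows "nn_norm (corner_net d C b n k) \<le> C"
proof (rule nn_norm_le)
  show "corner_net d C b n k \<noteq> []" by (simp add: corner_net_def)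
  fix A v assume Av: "(A, v) \<in> set (corner_net d C b n k)"
  show "max_mat A \<le> C \<and> max_vec v \<le> C"
  proof (cases "(A, v) \<in> set (const_tail C n k)")
    case True
    then show ?thesis
      using assms
      by (auto intro!: max_mat_le max_vec_le elim!: const_tail_layers)
  next
    case False
    then show ?thesis
      using Av assms alternating_width_pos[OF assms(1), of k]
      by (auto simp: corner_net_def intro!: max_mat_le max_vec_le)
  qed
qed

section \<open>The bump and the zero function as network realizations\<close>

text \<open>\<open>M\<close> enters the network only through the bias \<open>C / M\<close>, and
  \<open>1 \<le> M\<close> keeps this bias within the weight bound \<open>C\<close>. The width
  \<open>n\<close> is kept apart from the budget \<open>m\<close> so that one fixed bump can be
  placed in \<open>Sigma_nn\<close> for all large \<open>m\<close>.\<close>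

lemma corner_bump_in_Sigma_nn:
  assumes "1 \<le> n" "2 \<le> L" "0 \<le> C" "1 \<le> M"
    and "(CARD('d) + L) * n \<le> m" "enat L \<le> \<l> m" "ennreal C \<le> ennreal_of_enat (c m)"
  shows "(corner_bump (C ^ L * real n ^ (L div 2)) M :: real ^ 'd \<Rightarrow> real) \<in> Sigma_nn \<l> c m"
proof -
  obtain k where L: "L = Suc k" and k: "0 < k" using assms(2) by (cases L) auto
  let ?\<Phi> = "corner_net CARD('d) C (C / M) n k"
  have CM: "C / M \<le> C" using assms(3,4) by (simp add: divide_le_eq mult_le_cancel_left1)
  have "corner_bump (C ^ L * real n ^ (L div 2)) M =
      (\<lambda>x :: real ^ 'd. vec_index (realize ?\<Phi> (coords x)) 0)"
    using realize_corner_net[OF assms(3) k, of M n, where 'd = 'd] by (auto simp: L)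
  moreover have "num_weights ?\<Phi> \<le> m"
    using num_weights_corner_net[OF assms(1), of "CARD('d)" C "C / M" k] assms(5) by (simp add: L)
  moreover have "ennreal (nn_norm ?\<Phi>) \<le> ennreal_of_enat (c m)"
    using nn_norm_corner_net[OF assms(1) _ assms(3) _ CM, of "CARD('d)" k] assms(3,4,7)
    by (meson ennreal_leI order_trans divide_nonneg_nonneg zero_less_card_finite zero_le_one)
  moreover have "d_in ?\<Phi> = CARD('d)" "enat (length ?\<Phi>) \<le> \<l> m"
    using assms(6) by (simp_all add: d_in_def corner_net_def L)
  ultimately show ?thesis
    unfolding Sigma_nn_def using is_network_corner_net[OF assms(1)] d_out_corner_net[OF k]
    by (auto intro!: exI[of _ ?\<Phi>])
qed

text \<open>Serves the budgets that are too small for the bump: there the distance to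
  \<open>Sigma_nn\<close> is at most the norm of the function.\<close>

lemma zero_in_Sigma_nn:
  assumes "1 \<le> \<l> m"
  shows "(\<lambda>_. 0) \<in> (Sigma_nn \<l> c m :: (real ^ 'd \<Rightarrow> real) set)"
proof -
  let ?A = "0\<^sub>m 1 CARD('d) :: real Matrix.mat" and ?b = "0\<^sub>v 1 :: real Matrix.vec"
  have "nn_norm [(?A, ?b)] \<le> 0"
    by (rule nn_norm_le) (auto intro!: max_mat_le max_vec_le)
  moreover have "num_weights [(?A, ?b)] = 0"
    by (simp only: num_weights_def list.map sum_list.Cons sum_list.Nil prod.case l0_zero add_0)
  moreover have "vec_index (realize [(?A, ?b)] (coords x)) 0 = 0" for x :: "real ^ 'd"
    by (simp add: coords_def scalar_prod_def)
  ultimately show ?thesis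
    unfolding Sigma_nn_def using assms
    by (auto intro!: exI[of _ "[(?A, ?b)]"]
        simp: is_network_def d_in_def d_out_def ennreal_neg one_enat_def)
qed

section \<open>Regularity and \<open>L^p\<close> norm of the bump\<close>

lemma continuous_on_corner_bump: "continuous_on A (corner_bump S M)"
  unfolding corner_bump_def by (intro continuous_intros)

lemma cube_sets [measurable]: "cube \<in> sets lebesgue"
  by (simp add: cube_def)

lemma corner_bump_measurable [measurable]:
  "corner_bump S M \<in> borel_measurable (lebesgue_on cube)"
  using continuous_on_corner_bump by (rule continuous_imp_measurable_on_sets_lebesgue) simp

lemma Lp_norm_zero: "Lp_norm p (\<lambda>_ :: real ^ 'd. 0) = 0"
proof -
  have "esssup (lebesgue_on (cube :: (real ^ 'd) set)) (\<lambda>_. 0 :: ennreal) \<le> 0"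
    by (rule esssup_I) auto
  then show ?thesis by (simp add: Lp_norm_def Let_def)
qed

lemma cube_nonneg: "x \<in> cube \<Longrightarrow> 0 \<le> x $ i"
  by (auto simp: cube_def mem_box_cart)

lemma corner_bump_bounds:
  assumes "0 \<le> S" "0 < M" "x \<in> cube"
  shows "0 \<le> corner_bump S M x" "corner_bump S M x \<le> S / M"
proof -
  have "0 \<le> (\<Sum>i\<in>UNIV. x $ i)" using cube_nonneg[OF assms(3)] by (intro sum_nonneg) auto
  then have "max 0 (1 / M - (\<Sum>i\<in>UNIV. x $ i)) \<le> 1 / M" using assms(2) by simp
  from mult_left_mono[OF this assms(1)] show "corner_bump S M x \<le> S / M"
    by (simp add: corner_bump_def)
  show "0 \<le> corner_bump S M x" using assms(1) by (simp add: corner_bump_def)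
qed

lemma corner_bump_support:
  assumes "x \<in> cube" "corner_bump S M x \<noteq> 0"
  shows "x \<in> cbox 0 (\<chi> i. 1 / M)"
proof -
  have "(\<Sum>i\<in>UNIV. x $ i) \<le> 1 / M"
    using assms(2) by (auto simp: corner_bump_def max_def split: if_splits)
  moreover have "x $ i \<le> (\<Sum>i\<in>UNIV. x $ i)" for i
    using cube_nonneg[OF assms(1)] by (intro member_le_sum) auto
  ultimately show ?thesis
    using cube_nonneg[OF assms(1)] by (auto simp: mem_box_cart intro: order_trans)
qed

text \<open>The bump is at most \<open>S / M\<close> high and lives in a box of volume
  \<open>M^(-d)\<close>; the \<open>p\<close>-th root turns the volume into \<open>M^(-d/p)\<close>.
  For infinite \<open>p\<close> only the height remains, in line with the value 0 of
  \<open>d_over_p\<close>.\<close>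

lemma Lp_norm_corner_bump:
  assumes "0 < p" "0 \<le> S" "0 < M"
  shows "Lp_norm p (corner_bump S M :: real ^ 'd \<Rightarrow> real) \<le>
           ennreal (S / M * M powr (- d_over_p CARD('d) p))"
proof (cases "p = \<infinity>")
  case True
  have "esssup (lebesgue_on cube) (\<lambda>x :: real ^ 'd. ennreal \<bar>corner_bump S M x\<bar>) \<le> ennreal (S / M)"
    by (intro esssup_I)
       (auto intro!: AE_I2 ennreal_leI simp: space_restrict_space corner_bump_bounds[OF assms(2,3)])
  then show ?thesis using True assms(3) by (simp add: Lp_norm_def d_over_p_def)
next
  case False
  define r where "r = enn2real p"
  have r: "0 < r" using False assms(1) by (simp add: r_def enn2real_positive_iff less_top)
  let ?B = "cbox 0 (\<chi> i. 1 / M) :: (real ^ 'd) set"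
  let ?K = "(S / M) powr r"
  define I where "I = (\<integral>\<^sup>+x. ennreal (\<bar>corner_bump S M (x :: real ^ 'd)\<bar> powr r) \<partial>lebesgue_on cube)"
  have ne: "?B \<noteq> {}" using assms(3) by (simp add: interval_ne_empty_cart)
  have meas: "emeasure lebesgue ?B = ennreal (M powr - real CARD('d))"
  proof -
    have "emeasure lebesgue ?B = ennreal (measure lborel ?B)"
      using emeasure_eq_ennreal_measure[of lborel ?B] emeasure_lborel_cbox_finite[of 0 "\<chi> i. 1 / M"]
      by (simp add: less_top)
    also have "measure lborel ?B = (1 / M) ^ CARD('d)"
      using content_cbox_cart[OF ne] by simp
    also have "\<dots> = M powr - real CARD('d)"
      using assms(3) by (simp add: powr_minus powr_realpow power_one_over field_simps)
    finally show ?thesis .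
  qed
  have "I = (\<integral>\<^sup>+x. ennreal (\<bar>corner_bump S M (x :: real ^ 'd)\<bar> powr r) * indicator cube x \<partial>lebesgue)"
    unfolding I_def by (subst nn_integral_restrict_space) auto
  also have "\<dots> \<le> (\<integral>\<^sup>+x. ennreal ?K * indicator ?B x \<partial>lebesgue)"
  proof (rule nn_integral_mono)
    fix x :: "real ^ 'd"
    \<comment> \<open>Outside the cube the indicator vanishes, and at zeros of the bump the
      integrand vanishes since \<open>0 powr r = 0\<close>. Only the support is left to
      estimate.\<close>
    show "ennreal (\<bar>corner_bump S M x\<bar> powr r) * indicator cube x \<le> ennreal ?K * indicator ?B x"
    proof (cases "x \<in> cube \<and> corner_bump S M x \<noteq> 0")
      case True
      then have "\<bar>corner_bump S M x\<bar> powr r \<le> ?K"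
        using corner_bump_bounds[OF assms(2,3), of x] r by (intro powr_mono2) auto
      with True corner_bump_support[of x S M] show ?thesis by (auto intro: ennreal_leI)
    qed (auto simp: indicator_def)
  qed
  also have "\<dots> = ennreal ?K * emeasure lebesgue ?B"
    by (rule nn_integral_cmult_indicator) simp
  also have "\<dots> = ennreal (?K * M powr - real CARD('d))"
    by (simp add: meas ennreal_mult)
  finally have I: "I \<le> ennreal (?K * M powr - real CARD('d))" .
  \<comment> \<open>Finiteness selects the second branch of \<open>Lp_norm\<close> and makes
    \<open>enn2real I\<close> the true value of the integral.\<close>
  then have fin: "I \<noteq> \<infinity>" by (auto simp: top_unique)
  have "enn2real I \<le> ?K * M powr - real CARD('d)"
    using I by (simp add: enn2real_leI)
  then have "enn2real I powr (1 / r) \<le> (?K * M powr - real CARD('d)) powr (1 / r)"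
    using r by (intro powr_mono2) auto
  also have "\<dots> = S / M * M powr (- (real CARD('d) / r))"
    using assms(2,3) r by (simp add: powr_mult powr_powr)
  finally show ?thesis
    using False fin by (simp add: Lp_norm_def Let_def I_def[symmetric] r_def[symmetric] d_over_p_def ennreal_leI)
qed

section \<open>Membership in the unit ball of the approximation space\<close>

text \<open>From budget \<open>N\<close> on the error is zero. Below \<open>N\<close> the zero
  function has error at most \<open>N^(-\<alpha>)\<close>, which the weight
  \<open>m^\<alpha> \<le> N^\<alpha>\<close> raises to at most 1. So \<open>t = 1\<close> is
  admissible in the infimum.\<close>

lemma A_norm_le_one:
  fixes f :: "real ^ 'd \<Rightarrow> real"
  assumes "0 < \<alpha>" "1 \<le> N" "Lp_norm p f \<le> ennreal (real N powr - \<alpha>)"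
    and "\<And>m. N \<le> m \<Longrightarrow> f \<in> Sigma_nn \<l> c m" "\<And>m. 1 \<le> m \<Longrightarrow> 1 \<le> \<l> m"
  shows "A_norm \<alpha> p \<l> c f \<le> 1"
proof -
  have "ennreal (real m powr \<alpha>) * Lp_dist p f (Sigma_nn \<l> c m) \<le> 1" if "1 \<le> m" for m
  proof (cases "N \<le> m")
    case True
    then have "Lp_dist p f (Sigma_nn \<l> c m) \<le> Lp_norm p (\<lambda>x. f x - f x)"
      unfolding Lp_dist_def using assms(4) by (intro INF_lower) auto
    then show ?thesis by (simp add: Lp_norm_zero)
  next
    case False
    have "Lp_dist p f (Sigma_nn \<l> c m) \<le> Lp_norm p (\<lambda>x. f x - 0)"
      unfolding Lp_dist_def
      by (rule INF_lower2[OF zero_in_Sigma_nn[of \<l> m c, OF assms(5)[OF that]]]) simp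
    also have "\<dots> \<le> ennreal (real N powr - \<alpha>)" using assms(3) by simp
    finally have "ennreal (real m powr \<alpha>) * Lp_dist p f (Sigma_nn \<l> c m) \<le>
        ennreal (real m powr \<alpha>) * ennreal (real N powr - \<alpha>)"
      by (rule mult_left_mono) simp
    also have "\<dots> = ennreal (real m powr \<alpha> * real N powr - \<alpha>)" by (simp add: ennreal_mult)
    also have "\<dots> \<le> ennreal (real N powr \<alpha> * real N powr - \<alpha>)"
      using False assms(1) by (intro ennreal_leI mult_right_mono powr_mono2) auto
    also have "\<dots> = 1" using assms(2) by (simp add: powr_add[symmetric])
    finally show ?thesis .
  qed
  moreover have "Lp_norm p f \<le> 1"
  proof -
    have "real N powr - \<alpha> \<le> real N powr 0" using assms(1,2) by (intro powr_mono) auto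
    then have "ennreal (real N powr - \<alpha>) \<le> 1" using assms(2) by (simp add: ennreal_le_1)
    with assms(3) show ?thesis by (rule order_trans)
  qed
  ultimately have "Gamma_ap \<alpha> p \<l> c (\<lambda>x. f x / 1) \<le> 1"
    unfolding Gamma_ap_def by (auto intro!: SUP_least)
  then show ?thesis
    unfolding A_norm_def by (intro INF_lower2[of 1]) auto
qed

section \<open>Uniqueness of continuous representatives\<close>

text \<open>Continuous functions that differ at one point of the cube differ on a nonempty open set,
  which is not negligible. Pointwise values of the bump thus transfer to the representative given by
  an embedding.\<close>

lemma AE_eq_imp_eq_on_cube:
  fixes f g :: "real ^ 'd \<Rightarrow> real"
  assumes "continuous_on cube f" "continuous_on cube g"
    and AE: "AE x in lebesgue_on cube. f x = g x" and "x \<in> cube"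
  shows "f x = g x"
proof (rule ccontr)
  assume "f x \<noteq> g x"
  have "continuous_on cube (\<lambda>y. f y - g y)" using assms(1,2) by (intro continuous_intros)
  then obtain T where T: "open T" "T \<inter> cube = (\<lambda>y. f y - g y) -` (- {0}) \<inter> cube"
    unfolding continuous_on_open_invariant by (metis open_Compl closed_singleton)
  have "x \<in> T" using \<open>f x \<noteq> g x\<close> \<open>x \<in> cube\<close> T(2) by auto
  \<comment> \<open>The point may lie on the boundary, as the corner \<open>0\<close> does, so
    \<open>T\<close> is intersected with the open cube, whose closure contains
    \<open>x\<close>.\<close>
  moreover have "box 0 (1 :: real ^ 'd) \<noteq> {}" by (simp add: interval_ne_empty_cart)
  then have "x \<in> closure (box 0 1)" using \<open>x \<in> cube\<close> by (simp add: cube_def)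
  ultimately have ne: "T \<inter> box 0 1 \<noteq> {}"
    using T(1) by (metis closure_iff_nhds_not_empty inf_commute open_contains_ball subset_refl)
  have "AE y in lebesgue. y \<in> cube \<longrightarrow> f y = g y"
    using AE by (simp add: AE_restrict_space_iff)
  then have "AE y in lebesgue. y \<notin> T \<inter> box 0 1"
  proof eventually_elim
    case (elim y)
    then show ?case using T(2) box_subset_cbox[of 0 1] by (auto simp: cube_def)
  qed
  then have "negligible (T \<inter> box 0 1)"
    using T(1) by (subst negligible_iff_null_sets, subst AE_iff_null_sets) auto
  then show False using open_not_negligible ne T(1) by (metis open_Int open_box)
qed

text \<open>Since \<open>infnorm\<close> is at most \<open>norm\<close>, a finite constant yields
  the Euclidean modulus of continuity \<open>K * norm (x - y) powr \<beta>\<close>. This makes the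
  uniqueness result available for Hoelder functions.\<close>

lemma continuous_on_if_Lip_const_finite:
  fixes g :: "real ^ 'd \<Rightarrow> real"
  assumes "0 < \<beta>" "Lip_const \<beta> g < \<infinity>"
  shows "continuous_on cube g"
proof -
  define K where "K = enn2real (Lip_const \<beta> g)"
  have lip: "\<bar>g x - g y\<bar> \<le> K * norm (x - y) powr \<beta>" if "x \<in> cube" "y \<in> cube" for x y
  proof (cases "x = y")
    case False
    have "ennreal (\<bar>g x - g y\<bar> / infnorm (x - y) powr \<beta>) \<le> Lip_const \<beta> g"
      unfolding Lip_const_def using that False by (intro SUP_upper2[of "(x, y)"]) auto
    also have "\<dots> = ennreal K" using assms(2) by (simp add: K_def)
    finally have "\<bar>g x - g y\<bar> / infnorm (x - y) powr \<beta> \<le> K" by (simp add: K_def)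
    then have "\<bar>g x - g y\<bar> \<le> K * infnorm (x - y) powr \<beta>"
      using False by (simp add: pos_divide_le_eq infnorm_eq_0)
    also have "\<dots> \<le> K * norm (x - y) powr \<beta>"
      using assms(1) by (intro mult_left_mono powr_mono2 infnorm_le_norm) (auto simp: K_def infnorm_pos_le)
    finally show ?thesis .
  qed simp
  show ?thesis
    unfolding continuous_on_def
  proof
    fix x :: "real ^ 'd" assume x: "x \<in> cube"
    \<comment> \<open>The base tends to 0, where continuity of \<open>powr\<close> relies on the
      positive exponent.\<close>
    have "((\<lambda>y. K * norm (y - x) powr \<beta>) \<longlongrightarrow> K * norm (x - x) powr \<beta>) (at x within cube)"
      using assms(1) by (intro tendsto_intros tendsto_powr') auto
    then have "((\<lambda>y. K * norm (y - x) powr \<beta>) \<longlongrightarrow> 0) (at x within cube)" by simp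
    then have "((\<lambda>y. g y - g x) \<longlongrightarrow> 0) (at x within cube)"
      by (rule Lim_null_comparison[rotated]) (auto simp: eventually_at_filter lip x)
    then show "(g \<longlongrightarrow> g x) (at x within cube)" by (rule LIM_zero_cancel)
  qed
qed

section \<open>Slopes and depths supplied by the complexity exponent\<close>

text \<open>Take \<open>\<gamma>\<close> strictly between \<open>\<tau>\<close> and an exponent
  \<open>\<gamma>\<^sub>0\<close> with positive limes superior. If the slopes eventually stayed
  below \<open>n^\<gamma>\<close>, the quotients for \<open>\<gamma>\<^sub>0\<close> would be at
  most \<open>n^(\<gamma> - \<gamma>\<^sub>0)\<close> and tend to 0. The real \<open>C\<close> below
  \<open>c n\<close> covers finite and infinite \<open>c n\<close> alike.\<close>

lemma gamma_star_frequently: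
  assumes "0 \<le> \<tau>" "ennreal \<tau> < gamma_star \<l> c"
    and "\<And>n. 1 \<le> n \<Longrightarrow> 2 \<le> \<l> n" "\<And>n. 1 \<le> n \<Longrightarrow> 1 \<le> c n"
  obtains \<gamma> L where "\<tau> < \<gamma>" "2 \<le> L" "enat L \<le> (SUP n\<in>{1..}. \<l> n)"
    "\<exists>\<^sub>F n in sequentially. \<exists>C\<ge>1. ennreal C \<le> ennreal_of_enat (c n) \<and>
       real n powr \<gamma> \<le> C ^ L * real n ^ (L div 2)"
proof -
  let ?r = "\<lambda>\<gamma> L n. ennreal_of_enat (c n) ^ L * of_nat n ^ (L div 2) / ennreal (real n powr \<gamma>)"
  obtain \<gamma>\<^sub>0 L\<^sub>0 where *: "ennreal \<tau> < ennreal \<gamma>\<^sub>0" "1 \<le> L\<^sub>0" "enat L\<^sub>0 \<le> (SUP n\<in>{1..}. \<l> n)"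
    "0 < limsup (?r \<gamma>\<^sub>0 L\<^sub>0)"
    using assms(2) unfolding gamma_star_def less_SUP_iff by blast
  have "\<tau> < \<gamma>\<^sub>0" using *(1) assms(1) by (simp add: ennreal_less_iff)
  then obtain \<gamma> where \<gamma>: "\<tau> < \<gamma>" "\<gamma> < \<gamma>\<^sub>0" using dense by blast
  \<comment> \<open>The bump needs a hidden layer; raising the depth only increases $c(n)^L n^{\lfloor L/2 \rfloor}$.\<close>
  define L where "L = max 2 L\<^sub>0"
  have "enat 2 \<le> (SUP n\<in>{1..}. \<l> n)"
    using assms(3)[of 1] by (intro SUP_upper2[of 1]) (auto simp: numeral_eq_enat)
  then have L: "enat L \<le> (SUP n\<in>{1..}. \<l> n)" using *(3) by (simp add: L_def max_def)
  let ?P = "\<lambda>n. \<exists>C\<ge>1. ennreal C \<le> ennreal_of_enat (c n) \<and>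
    real n powr \<gamma> \<le> C ^ L * real n ^ (L div 2)"
  have "\<exists>\<^sub>F n in sequentially. ?P n"
  proof (rule ccontr)
    assume "\<not> (\<exists>\<^sub>F n in sequentially. ?P n)"
    then have "\<forall>\<^sub>F n in sequentially. \<not> ?P n" by (simp add: not_frequently)
    then have "\<forall>\<^sub>F n in sequentially. ?r \<gamma>\<^sub>0 L\<^sub>0 n \<le> ennreal (real n powr (\<gamma> - \<gamma>\<^sub>0))"
      using eventually_ge_at_top[of 1]
    proof eventually_elim
      case (elim n)
      show ?case
      proof (cases "c n")
        case infinity
        let ?C = "max 1 (real n powr \<gamma>)"
        have "real n powr \<gamma> \<le> ?C" by simp
        also have "\<dots> \<le> ?C ^ L" by (rule self_le_power) (auto simp: L_def)
        also have "\<dots> \<le> ?C ^ L * real n ^ (L div 2)" using elim(2) by (simp add: mult_le_cancel_left1)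
        finally have "?P n" using infinity by (intro exI[of _ ?C]) auto
        with elim(1) show ?thesis by blast
      next
        case (enat N)
        have N: "1 \<le> real N" using assms(4)[OF elim(2)] enat by (simp add: one_enat_def)
        have "\<not> real n powr \<gamma> \<le> real N ^ L * real n ^ (L div 2)"
          using elim(1) N enat by (auto simp: ennreal_of_nat_eq_real_of_nat)
        moreover have "real N ^ L\<^sub>0 * real n ^ (L\<^sub>0 div 2) \<le> real N ^ L * real n ^ (L div 2)"
          using N elim(2) by (intro mult_mono power_increasing) (auto simp: L_def div_le_mono)
        ultimately have "real N ^ L\<^sub>0 * real n ^ (L\<^sub>0 div 2) \<le> real n powr \<gamma>" by linarith
        then have "real N ^ L\<^sub>0 * real n ^ (L\<^sub>0 div 2) / real n powr \<gamma>\<^sub>0 \<le>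
            real n powr \<gamma> / real n powr \<gamma>\<^sub>0"
          by (rule divide_right_mono) simp
        moreover have "?r \<gamma>\<^sub>0 L\<^sub>0 n = ennreal (real N ^ L\<^sub>0 * real n ^ (L\<^sub>0 div 2) / real n powr \<gamma>\<^sub>0)"
          using elim(2) enat
          by (simp add: ennreal_of_nat_eq_real_of_nat ennreal_power ennreal_mult[symmetric] divide_ennreal)
        ultimately show ?thesis by (simp add: powr_diff ennreal_leI)
      qed
    qed
    then have "limsup (?r \<gamma>\<^sub>0 L\<^sub>0) \<le> limsup (\<lambda>n. ennreal (real n powr (\<gamma> - \<gamma>\<^sub>0)))"
      by (rule Limsup_mono)
    also have "\<dots> = 0"
    proof (rule lim_imp_Limsup)
      have "(\<lambda>n. real n powr (\<gamma> - \<gamma>\<^sub>0)) \<longlonglongrightarrow> 0"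
        using \<gamma>(2) by (intro tendsto_neg_powr filterlim_real_sequentially) simp
      then show "(\<lambda>n. ennreal (real n powr (\<gamma> - \<gamma>\<^sub>0))) \<longlonglongrightarrow> 0"
        using tendsto_ennrealI by fastforce
    qed simp
    finally show False using *(4) by simp
  qed
  with \<gamma>(1) L show thesis by (intro that[of \<gamma> L]) (auto simp: L_def)
qed

text \<open>In \<open>enat\<close>, values below \<open>L\<close> are at most \<open>L - 1\<close>,
  so a finite \<open>L\<close> up to the supremum is reached by some value; monotonicity does the
  rest.\<close>

lemma eventually_ge_SUP_depth:
  fixes \<l> :: "nat \<Rightarrow> enat"
  assumes "mono_on {1..} \<l>" "enat L \<le> (SUP n\<in>{1..}. \<l> n)" "1 \<le> L"
  shows "\<forall>\<^sub>F n in sequentially. enat L \<le> \<l> n"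
proof -
  have "\<exists>n\<ge>1. enat L \<le> \<l> n"
  proof (rule ccontr)
    assume *: "\<not> ?thesis"
    have "\<l> n \<le> enat (L - 1)" if "1 \<le> n" for n
    proof -
      have "\<l> n < enat L" using * that by (metis not_le)
      then show ?thesis by (cases "\<l> n") auto
    qed
    then have "(SUP n\<in>{1..}. \<l> n) \<le> enat (L - 1)" by (intro SUP_least) auto
    with assms(2) have "enat L \<le> enat (L - 1)" by (rule order_trans)
    with assms(3) show False by simp
  qed
  then obtain n0 where "1 \<le> n0" "enat L \<le> \<l> n0" by blast
  then show ?thesis
    using assms(1) by (auto intro!: eventually_sequentiallyI[of n0] elim: order_trans dest: mono_onD)
qed

section \<open>Unbounded Hoelder quotients in the unit ball\<close>

text \<open>Admitting \<open>\<beta> = 0\<close> lets one statement serve both embeddings; in that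
  case \<open>0 < \<beta> + q\<close> amounts to finiteness of \<open>p\<close>. The bound
  \<open>B\<close> is arbitrary, so it can be chosen beyond any embedding constant.\<close>

lemma corner_bump_unbounded:
  fixes \<alpha> \<beta> :: real and p :: ennreal and \<l> c :: "nat \<Rightarrow> enat"
  defines "q \<equiv> d_over_p CARD('d) p"
  assumes "0 < p" "0 < \<alpha>" "0 \<le> \<beta>" "\<beta> \<le> 1" "0 < \<beta> + q"
    and l: "\<And>n. 1 \<le> n \<Longrightarrow> 2 \<le> \<l> n" "mono_on {1..} \<l>"
    and c: "\<And>n. 1 \<le> n \<Longrightarrow> 1 \<le> c n" "mono_on {1..} c"
    and gs: "ennreal ((1 - \<beta>) / (\<beta> + q) * \<alpha>) < gamma_star \<l> c"
  obtains S M where "1 \<le> M" "B \<le> S / M * M powr \<beta>"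
    "(corner_bump S M :: real ^ 'd \<Rightarrow> real) \<in> A_space \<alpha> p \<l> c"
    "A_norm \<alpha> p \<l> c (corner_bump S M :: real ^ 'd \<Rightarrow> real) \<le> 1"
proof -
  have q: "0 \<le> q" by (simp add: q_def d_over_p_def)
  have "0 \<le> (1 - \<beta>) / (\<beta> + q) * \<alpha>" using assms(3,5,6) by simp
  from gamma_star_frequently[OF this gs l(1) c(1)]
  obtain \<gamma> L where \<gamma>: "(1 - \<beta>) / (\<beta> + q) * \<alpha> < \<gamma>"
    and L: "2 \<le> L" "enat L \<le> (SUP n\<in>{1..}. \<l> n)"
    and freq: "\<exists>\<^sub>F n in sequentially. \<exists>C\<ge>1. ennreal C \<le> ennreal_of_enat (c n) \<and>
       real n powr \<gamma> \<le> C ^ L * real n ^ (L div 2)" by blast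
  \<comment> \<open>\<open>K * n\<close> bounds the number of weights of the depth-\<open>L\<close>
    network of width \<open>n\<close>.\<close>
  define K where "K = CARD('d) + L"
  have K: "1 \<le> K" using L(1) by (simp add: K_def)
  \<comment> \<open>With \<open>M\<close> as chosen below, \<open>M powr (1 - \<beta>)\<close> is
    \<open>(S * real N powr \<alpha>) powr u\<close>, so the Hoelder quotient equals
    \<open>S^(1-u) N^(-\<alpha> u)\<close>.\<close>
  define u where "u = (1 - \<beta>) / (1 + q)"
  have u: "0 \<le> u" "1 - u = (\<beta> + q) / (1 + q)"
    using assms(5) q by (simp_all add: u_def field_simps)
  \<comment> \<open>The power of \<open>n\<close> in the lower bound for that quotient when
    \<open>S \<ge> n^\<gamma>\<close> and \<open>N = K n\<close>. The choice of
    \<open>\<gamma>\<close> makes it positive.\<close>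
  define e where "e = \<gamma> * (1 - u) - \<alpha> * u"
  have "(1 - \<beta>) * \<alpha> < \<gamma> * (\<beta> + q)" using \<gamma> assms(6) by (simp add: field_simps)
  moreover have "e = (\<gamma> * (\<beta> + q) - \<alpha> * (1 - \<beta>)) / (1 + q)"
    by (simp add: e_def u(2)) (simp add: u_def diff_divide_distrib right_diff_distrib)
  ultimately have e: "0 < e" using q by (simp add: mult.commute)
  have "filterlim (\<lambda>n. real n powr e) at_top sequentially"
    using e by real_asymp
  \<comment> \<open>The divisor is the constant factor that \<open>K\<close> contributes through
    \<open>N = K n\<close>.\<close>
  then have "\<forall>\<^sub>F n in sequentially. B / real K powr (- \<alpha> * u) \<le> real n powr e"
    by (simp add: filterlim_at_top)
  moreover have "\<forall>\<^sub>F n in sequentially. enat L \<le> \<l> n"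
    using L by (intro eventually_ge_SUP_depth[OF l(2)]) auto
  ultimately have "\<forall>\<^sub>F n in sequentially. 1 \<le> n \<and> enat L \<le> \<l> n \<and>
      B / real K powr (- \<alpha> * u) \<le> real n powr e"
    using eventually_ge_at_top[of 1] by eventually_elim auto
  from frequently_ex[OF frequently_eventually_frequently[OF freq this]]
  obtain n C where n: "1 \<le> n" "enat L \<le> \<l> n" "B / real K powr (- \<alpha> * u) \<le> real n powr e"
    and C: "1 \<le> C" "ennreal C \<le> ennreal_of_enat (c n)" "real n powr \<gamma> \<le> C ^ L * real n ^ (L div 2)"
    by blast
  define S where "S = C ^ L * real n ^ (L div 2)"
  define N where "N = K * n"
  define M where "M = (S * real N powr \<alpha>) powr (1 / (1 + q))"
  have N: "1 \<le> N" "n \<le> N" using K n(1) by (simp_all add: N_def)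
  have S: "1 \<le> S" using C(1) n(1) by (simp add: S_def mult_ge1_I one_le_power)
  have "1 \<le> real N powr \<alpha>" using N(1) assms(3) by (simp add: ge_one_powr_ge_zero)
  \<comment> \<open>A base of at least 1 gives \<open>1 \<le> M\<close>, as the networks
    require.\<close>
  with S have SN: "1 \<le> S * real N powr \<alpha>" by (rule mult_ge1_I)
  then have M: "1 \<le> M" using q by (simp add: M_def ge_one_powr_ge_zero)
  have Mq: "M powr (1 + q) = S * real N powr \<alpha>"
    using SN q by (simp add: M_def powr_powr)
  have "S / M * M powr (- q) = S / M powr (1 + q)"
    using M by (simp add: powr_add powr_minus field_simps)
  also have "\<dots> = real N powr - \<alpha>"
    using S by (simp add: Mq powr_minus field_simps)
  finally have norm: "S / M * M powr (- q) = real N powr - \<alpha>" .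
  have "S / M * M powr \<beta> = S * M powr (- (1 - \<beta>))"
    using M by (simp add: powr_diff powr_minus field_simps)
  also have "M powr (- (1 - \<beta>)) = (S * real N powr \<alpha>) powr (- u)"
    by (simp add: M_def u_def powr_powr minus_divide_left)
  also have "S * \<dots> = S powr (1 - u) * real N powr (- \<alpha> * u)"
    using S by (simp add: powr_mult powr_powr powr_diff powr_minus field_simps)
  finally have height: "S / M * M powr \<beta> = S powr (1 - u) * real N powr (- \<alpha> * u)" .
  have "B \<le> real n powr e * real K powr (- \<alpha> * u)"
    using n(3) K by (simp add: divide_le_eq)
  also have "\<dots> = (real n powr \<gamma>) powr (1 - u) * real N powr (- \<alpha> * u)"
    using n(1) by (simp add: e_def N_def powr_mult powr_powr powr_diff powr_minus powr_add field_simps)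
  also have "\<dots> \<le> S powr (1 - u) * real N powr (- \<alpha> * u)"
    using C(3) assms(6) q u(2) by (intro mult_right_mono powr_mono2) (auto simp: S_def)
  finally have B: "B \<le> S / M * M powr \<beta>" by (simp only: height)
  let ?f = "corner_bump S M :: real ^ 'd \<Rightarrow> real"
  have Lp: "Lp_norm p ?f \<le> ennreal (real N powr - \<alpha>)"
    using Lp_norm_corner_bump[OF assms(2), of S M, where 'd = 'd] S M norm by (simp add: q_def)
  \<comment> \<open>Depth and weight bounds were obtained at index \<open>n\<close>; because
    \<open>n \<le> N \<le> m\<close>, monotonicity of both growth functions carries them to
    \<open>m\<close>.\<close>
  have Sigma: "?f \<in> Sigma_nn \<l> c m" if "N \<le> m" for m
    unfolding S_def
  proof (rule corner_bump_in_Sigma_nn[OF n(1) L(1)])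
    have nm: "n \<le> m" using that N(2) by simp
    then have "\<l> n \<le> \<l> m" "c n \<le> c m" using n(1) by (auto intro: mono_onD[OF l(2)] mono_onD[OF c(2)])
    with n(2) C(2) show "enat L \<le> \<l> m" "ennreal C \<le> ennreal_of_enat (c m)"
      by (auto elim: order_trans)
  qed (use C(1) M that in \<open>auto simp: N_def K_def\<close>)
  have norm1: "A_norm \<alpha> p \<l> c ?f \<le> 1"
    by (intro A_norm_le_one[OF assms(3) N(1) Lp Sigma] order_trans[OF one_le_numeral l(1)])
  moreover have "?f \<in> A_space \<alpha> p \<l> c"
    using le_less_trans[OF Lp ennreal_less_top] le_less_trans[OF norm1 ennreal_one_less_top]
    by (simp add: A_space_def Lp_space_def)
  ultimately show thesis using M B by (intro that)
qed

section \<open>Failure of the two embeddings\<close>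

theorem theorem3p6:
  fixes p :: ennreal and \<alpha> \<beta> :: real and \<l> c :: "nat \<Rightarrow> enat"
  assumes "0 < p" and "0 < \<beta>" and "\<beta> \<le> 1" and "0 < \<alpha>"
    and "\<And>n. 1 \<le> n \<Longrightarrow> 2 \<le> \<l> n" and "mono_on {1..} \<l>"
    and "\<And>n. 1 \<le> n \<Longrightarrow> 1 \<le> c n" and "mono_on {1..} c"
  shows "(p < \<infinity> \<and> gamma_star \<l> c > ennreal (\<alpha> / d_over_p CARD('d) p) \<longrightarrow>
           \<not> embeds (A_space \<alpha> p \<l> c :: (real ^ 'd \<Rightarrow> real) set) (A_norm \<alpha> p \<l> c) C_space C_norm) \<and>
         (gamma_star \<l> c > ennreal ((1 - \<beta>) / (\<beta> + d_over_p CARD('d) p) * \<alpha>) \<longrightarrow>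
           \<not> embeds (A_space \<alpha> p \<l> c :: (real ^ 'd \<Rightarrow> real) set) (A_norm \<alpha> p \<l> c)
               (Hoelder_space \<beta>) (Hoelder_norm \<beta>))"
proof (intro conjI impI notI)
  let ?q = "d_over_p CARD('d) p"
  have zero: "0 \<in> (cube :: (real ^ 'd) set)" by (simp add: cube_def mem_box_cart)
  have at_zero: "corner_bump S M (0 :: real ^ 'd) = S / M" if "1 \<le> M" for S M
    using that by (simp add: corner_bump_def)
  {
    assume hyp: "p < \<infinity> \<and> gamma_star \<l> c > ennreal (\<alpha> / ?q)"
      and "embeds (A_space \<alpha> p \<l> c :: (real ^ 'd \<Rightarrow> real) set) (A_norm \<alpha> p \<l> c) C_space C_norm"
    then obtain K where K: "0 < K" and emb: "\<And>f. f \<in> A_space \<alpha> p \<l> c \<Longrightarrow>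
        \<exists>g\<in>C_space. (AE x in lebesgue_on (cube :: (real ^ 'd) set). f x = g x) \<and>
          C_norm g \<le> ennreal K * A_norm \<alpha> p \<l> c f"
      unfolding embeds_def by blast
    \<comment> \<open>Finiteness of \<open>p\<close> enters here: it makes \<open>d / p\<close>
      positive, so the case \<open>\<beta> = 0\<close> applies.\<close>
    have q: "0 < 0 + ?q" using hyp assms(1) by (auto simp: d_over_p_def enn2real_positive_iff)
    have gs: "ennreal ((1 - 0) / (0 + ?q) * \<alpha>) < gamma_star \<l> c" using hyp by simp
    \<comment> \<open>\<open>K + 1\<close> exceeds the embedding constant, and
      \<open>M powr 0 = 1\<close> leaves the height of the bump, attained at the corner.\<close>
    obtain S M where SM: "1 \<le> M" "K + 1 \<le> S / M * M powr 0"
      "(corner_bump S M :: real ^ 'd \<Rightarrow> real) \<in> A_space \<alpha> p \<l> c"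
      "A_norm \<alpha> p \<l> c (corner_bump S M :: real ^ 'd \<Rightarrow> real) \<le> 1"
      by (rule corner_bump_unbounded[OF assms(1,4) order_refl zero_le_one q assms(5-8) gs])
    from emb[OF SM(3)] obtain g where g: "g \<in> C_space"
      "AE x in lebesgue_on (cube :: (real ^ 'd) set). corner_bump S M x = g x"
      "C_norm g \<le> ennreal K * A_norm \<alpha> p \<l> c (corner_bump S M :: real ^ 'd \<Rightarrow> real)" by blast
    have "g 0 = S / M"
      using AE_eq_imp_eq_on_cube[OF continuous_on_corner_bump _ g(2) zero] g(1) at_zero[OF SM(1)]
      by (simp add: C_space_def)
    moreover have "ennreal \<bar>g 0\<bar> \<le> C_norm g"
      unfolding C_norm_def by (rule SUP_upper[OF zero])
    moreover have "C_norm g \<le> ennreal K"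
      using order_trans[OF g(3) mult_left_mono[OF SM(4)]] by simp
    ultimately have "ennreal \<bar>S / M\<bar> \<le> ennreal K" by simp
    then have "S / M \<le> K" using K by (simp only: ennreal_le_iff less_imp_le abs_le_iff)
    then show False using SM(1,2) by simp
  }
  {
    assume hyp: "gamma_star \<l> c > ennreal ((1 - \<beta>) / (\<beta> + ?q) * \<alpha>)"
      and "embeds (A_space \<alpha> p \<l> c :: (real ^ 'd \<Rightarrow> real) set) (A_norm \<alpha> p \<l> c)
        (Hoelder_space \<beta>) (Hoelder_norm \<beta>)"
    then obtain K where K: "0 < K" and emb: "\<And>f. f \<in> A_space \<alpha> p \<l> c \<Longrightarrow>
        \<exists>g\<in>Hoelder_space \<beta>. (AE x in lebesgue_on (cube :: (real ^ 'd) set). f x = g x) \<and>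
          Hoelder_norm \<beta> g \<le> ennreal K * A_norm \<alpha> p \<l> c f"
      unfolding embeds_def by blast
    have q: "0 < \<beta> + ?q" using assms(2) by (simp add: d_over_p_def add_pos_nonneg)
    obtain S M where SM: "1 \<le> M" "K + 1 \<le> S / M * M powr \<beta>"
      "(corner_bump S M :: real ^ 'd \<Rightarrow> real) \<in> A_space \<alpha> p \<l> c"
      "A_norm \<alpha> p \<l> c (corner_bump S M :: real ^ 'd \<Rightarrow> real) \<le> 1"
      by (rule corner_bump_unbounded[OF assms(1,4) less_imp_le[OF assms(2)] assms(3) q assms(5-8) hyp])
    from emb[OF SM(3)] obtain g where g: "g \<in> Hoelder_space \<beta>"
      "AE x in lebesgue_on (cube :: (real ^ 'd) set). corner_bump S M x = g x"
      "Hoelder_norm \<beta> g \<le> ennreal K * A_norm \<alpha> p \<l> c (corner_bump S M :: real ^ 'd \<Rightarrow> real)" by blast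
    have "Lip_const \<beta> g < \<infinity>" using g(1) by (simp add: Hoelder_space_def Hoelder_norm_def)
    then have cont: "continuous_on cube g"
      by (rule continuous_on_if_Lip_const_finite[OF assms(2)])
    obtain i :: 'd where True by simp
    \<comment> \<open>On an axis the coordinate sum reaches \<open>1 / M\<close> at distance
      \<open>1 / M\<close> from the corner, so the bump falls there from full height to 0.\<close>
    define y where "y = (axis i (1 / M) :: real ^ 'd)"
    have y: "y \<in> cube" using SM(1) by (auto simp: y_def cube_def mem_box_cart axis_def)
    have "(\<Sum>j\<in>UNIV. y $ j) = 1 / M" by (simp add: y_def axis_def)
    then have fy: "corner_bump S M y = 0" by (simp add: corner_bump_def)
    have "norm (0 - y) = 1 / M" using SM(1) by (simp add: y_def norm_eq_sqrt_inner inner_axis real_sqrt_divide)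
    then have inf: "infnorm (0 - y) \<le> 1 / M" "0 \<noteq> y"
      using SM(1) infnorm_le_norm[of "0 - y"] by auto
    have "g 0 = S / M" "g y = 0"
      using AE_eq_imp_eq_on_cube[OF continuous_on_corner_bump cont g(2)] zero y at_zero[OF SM(1)] fy
      by metis+
    have SMpos: "0 < S / M"
      using SM(1,2) K by (smt (verit) mult_nonpos_nonneg powr_ge_zero)
    have "S / M * M powr \<beta> = (S / M) / (1 / M) powr \<beta>"
      using SM(1) by (simp add: powr_divide)
    \<comment> \<open>An upper bound on the positive distance suffices, since a smaller distance
      only enlarges the quotient.\<close>
    also have "\<dots> \<le> (S / M) / infnorm (0 - y) powr \<beta>"
      using inf SMpos SM(1) assms(2) infnorm_pos_lt[of "0 - y"]
      by (intro divide_left_mono powr_mono2 mult_pos_pos) auto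
    also have "\<dots> = \<bar>g 0 - g y\<bar> / infnorm (0 - y) powr \<beta>"
      using SMpos by (simp only: \<open>g 0 = S / M\<close> \<open>g y = 0\<close> diff_0_right abs_of_pos)
    finally have "ennreal (S / M * M powr \<beta>) \<le> ennreal (\<bar>g 0 - g y\<bar> / infnorm (0 - y) powr \<beta>)"
      by (rule ennreal_leI)
    also have "\<dots> \<le> Lip_const \<beta> g"
      unfolding Lip_const_def using zero y inf(2) by (intro SUP_upper2[of "(0, y)"]) auto
    also have "\<dots> \<le> Hoelder_norm \<beta> g" by (simp add: Hoelder_norm_def)
    also have "\<dots> \<le> ennreal K"
      using order_trans[OF g(3) mult_left_mono[OF SM(4)]] by simp
    finally have "S / M * M powr \<beta> \<le> K" using K by simp
    then show False using SM(2) by simp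
  }
qed

end
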